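(* Let $k$ be a positive integer, $b=2k+1$, $N=\frac{b^3-1}{2}$ and $\mathbf{v}=(1,b,b^2)$. Let $\Pi_{N,\mathbf{v}}:=\{ (n \bmod N,\ nb \bmod N,\ nb^2 \bmod N) : 0 \leq n < N\}$ (residues in $\{0,\dots,N-1\}$) and $\lambda^{\ast}(\Pi_{N,\mathbf{v}}):=\min_{\mathbf{x}\neq\mathbf{y},\ \mathbf{x},\mathbf{y}\in\Pi_{N,\mathbf{v}}}\|\mathbf{x}-\mathbf{y}\|$ (Euclidean norm). Then $$ \lim_{k\rightarrow \infty} \frac{\lambda^{\ast}(\Pi_{N,\mathbf{v}})}{N^{2/3}} = 2^{1/6}. $$ *)

theory Defs
  imports "HOL-Analysis.Analysis"
begin

definition lattice_points :: "nat \<Rightarrow> nat ^ 'd \<Rightarrow> (real ^ 'd) set"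
  where "lattice_points N v = {\<chi> i. real ((n * v $ i) mod N) | n. n < N}"

(* Min is the true minimum only for a finite nonempty set of distances, i.e. for a finite
   point set with at least two elements. *)
definition min_dist :: "(real ^ 'd) set \<Rightarrow> real"
  where "min_dist P = Min {norm (x - y) | x y. x \<in> P \<and> y \<in> P \<and> x \<noteq> y}"

end

theory Submission
  imports Defs "HOL-Number_Theory.Cong" "HOL-Real_Asymp.Real_Asymp"
begin

text \<open>Since \<open>b\<^sup>3 = 2 N + 1\<close>, the differences of points of the set lie in the lattice of all integer
  vectors with \<open>b x - y = N p\<close>, \<open>b y - z = N q\<close>, \<open>b z - x = N r\<close>. Solving this cyclic system gives
  \<open>2 x = b\<^sup>2 p + b q + r\<close> and its cyclic shifts, so that (as \<open>b\<close> is odd) \<open>p + q + r\<close> is even: the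
  lattice is a slightly distorted face-centred cubic lattice. Its shortest vectors come from
  \<open>(p, q, r) = (1, -1, 0)\<close> and have squared norm \<open>(b - 1) N\<close>, and such a vector is the
  difference of the points with \<open>n = b (k + 1)\<close> and \<open>n = b\<close>.\<close>

text \<open>Squaring preserves parity, so the sum of squares is even as well as positive.\<close>

lemma even_sum_imp_sum_squares_ge_2:
  fixes p q r :: int
  assumes "even (p + q + r)" and "p \<noteq> 0 \<or> q \<noteq> 0 \<or> r \<noteq> 0"
  shows "p\<^sup>2 + q\<^sup>2 + r\<^sup>2 \<ge> 2"
proof -
  have "p\<^sup>2 + q\<^sup>2 + r\<^sup>2 > 0"
    using assms(2) by (smt (verit) zero_less_power2 zero_le_power2)
  moreover have "even (p\<^sup>2 + q\<^sup>2 + r\<^sup>2)"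
    using assms(1) by simp
  then have "p\<^sup>2 + q\<^sup>2 + r\<^sup>2 \<noteq> 1"
    by (metis odd_one)
  ultimately show ?thesis
    by linarith
qed

lemma cyclic_lattice_norm_ge:
  fixes x y z b N :: int
  assumes b: "b \<ge> 3" "odd b" and N: "b ^ 3 = 2 * N + 1"
    and dvd: "N dvd b * x - y" "N dvd b * y - z" "N dvd b * z - x"
    and nz: "x \<noteq> 0 \<or> y \<noteq> 0 \<or> z \<noteq> 0"
  shows "x\<^sup>2 + y\<^sup>2 + z\<^sup>2 \<ge> (b - 1) * N"
proof -
  obtain p q r where pqr: "b * x - y = N * p" "b * y - z = N * q" "b * z - x = N * r"
    using dvd by (auto elim!: dvdE)
  have "(3::int) ^ 3 \<le> b ^ 3"
    using b by (intro power_mono) auto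
  then have Npos: "N > 0"
    using N by simp
  \<comment> \<open>Weighting the three equations by \<open>b^2\<close>, \<open>b\<close>,
    \<open>1\<close> makes the left sides telescope to \<open>(b^3 - 1) * u = 2 * N * u\<close>. The
    variables are generic so that all three rotations of the system are instances.\<close>
  have cyclic: "2 * u = b\<^sup>2 * p' + b * q' + r'"
    if "b * u - v = N * p'" "b * v - w = N * q'" "b * w - u = N * r'" for u v w p' q' r' :: int
  proof -
    have "N * (2 * u) = (b ^ 3 - 1) * u"
      by (simp add: N)
    also have "\<dots> = b\<^sup>2 * (b * u - v) + b * (b * v - w) + (b * w - u)"
      by (simp add: power2_eq_square power3_eq_cube algebra_simps)
    also have "\<dots> = N * (b\<^sup>2 * p' + b * q' + r')"
      unfolding that by (simp add: algebra_simps)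
    finally show ?thesis
      using Npos by simp
  qed
  have x: "2 * x = b\<^sup>2 * p + b * q + r" and y: "2 * y = b\<^sup>2 * q + b * r + p"
    and z: "2 * z = b\<^sup>2 * r + b * p + q"
    using cyclic pqr by blast+
  have "even (b\<^sup>2 * p + b * q + r)"
    using x by (metis dvd_triv_left)
  then have "even (p + q + r)"
    using b by simp
  moreover have "p \<noteq> 0 \<or> q \<noteq> 0 \<or> r \<noteq> 0"
    using x y z nz by auto
  ultimately have ge2: "p\<^sup>2 + q\<^sup>2 + r\<^sup>2 \<ge> 2"
    by (rule even_sum_imp_sum_squares_ge_2)
  \<comment> \<open>The squares have coefficient \<open>b^4 + b^2 + 1\<close> and the mixed products
    \<open>2 * (b^3 + b^2 + b)\<close>; completing \<open>(p + q + r)^2\<close> leaves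
    \<open>(b - 1) * (b^3 - 1)\<close> on the squares. The nonnegative last term is dropped below,
    at no loss when \<open>p + q + r = 0\<close>.\<close>
  have form: "4 * (x\<^sup>2 + y\<^sup>2 + z\<^sup>2) =
      (b - 1) * (b ^ 3 - 1) * (p\<^sup>2 + q\<^sup>2 + r\<^sup>2) + (b ^ 3 + b\<^sup>2 + b) * (p + q + r)\<^sup>2"
  proof -
    have "4 * (x\<^sup>2 + y\<^sup>2 + z\<^sup>2) = (2 * x)\<^sup>2 + (2 * y)\<^sup>2 + (2 * z)\<^sup>2"
      by (simp add: power_mult_distrib)
    then show ?thesis
      unfolding x y z by algebra
  qed
  have "(b - 1) * N * 4 = (b - 1) * (b ^ 3 - 1) * 2"
    by (simp add: N)
  also have "\<dots> \<le> (b - 1) * (b ^ 3 - 1) * (p\<^sup>2 + q\<^sup>2 + r\<^sup>2)"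
    using ge2 b Npos N by (intro mult_left_mono mult_nonneg_nonneg) auto
  also have "\<dots> \<le> 4 * (x\<^sup>2 + y\<^sup>2 + z\<^sup>2)"
    using b unfolding form by simp
  finally show ?thesis
    by simp
qed

lemma norm_sq_3: "(norm (x :: real ^ 3))\<^sup>2 = (x $ 1)\<^sup>2 + (x $ 2)\<^sup>2 + (x $ 3)\<^sup>2"
  unfolding power2_norm_eq_inner by (simp add: inner_vec_def sum_3 power2_eq_square)

text \<open>Modulo \<open>N\<close>, multiplication by \<open>b\<close> carries the coordinate with
  multiplier \<open>s\<close> to the one with multiplier \<open>t\<close>. It is applied to
  \<open>(1, b)\<close>, \<open>(b, b^2)\<close> and, because \<open>b^3\<close> is 1 modulo
  \<open>N\<close>, to \<open>(b^2, 1)\<close>.\<close>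

lemma cyclic_dvd_mod_diff:
  fixes b N m n s t :: nat
  assumes "[s * b = t] (mod N)"
  shows "int N dvd int b * (int ((m * s) mod N) - int ((n * s) mod N))
    - (int ((m * t) mod N) - int ((n * t) mod N))"
proof -
  have *: "[int b * int ((i * s) mod N) = int ((i * t) mod N)] (mod int N)" for i
  proof -
    have "[b * ((i * s) mod N) = i * (s * b)] (mod N)"
      by (simp add: cong_def mod_mult_right_eq ac_simps)
    also have "[i * (s * b) = i * t] (mod N)"
      using assms by (rule cong_scalar_left)
    finally have "[b * ((i * s) mod N) = (i * t) mod N] (mod N)"
      by (simp add: cong_def)
    then show ?thesis
      by (metis cong_int_iff of_nat_mult)
  qed
  show ?thesis
    using cong_diff[OF *[of m] *[of n]] by (simp add: cong_iff_dvd_diff right_diff_distrib)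
qed

lemma lattice_points_dist_ge:
  fixes b N :: nat
  assumes b: "b \<ge> 3" "odd b" and N: "b ^ 3 = 2 * N + 1"
    and x: "x \<in> lattice_points N (vector [1, b, b\<^sup>2] :: nat ^ 3)"
    and y: "y \<in> lattice_points N (vector [1, b, b\<^sup>2] :: nat ^ 3)" and "x \<noteq> y"
  shows "norm (x - y) \<ge> sqrt ((real b - 1) * real N)"
proof -
  let ?v = "vector [1, b, b\<^sup>2] :: nat ^ 3"
  obtain m where m: "x = (\<chi> i. real ((m * ?v $ i) mod N))"
    using x unfolding lattice_points_def by blast
  obtain n where n: "y = (\<chi> i. real ((n * ?v $ i) mod N))"
    using y unfolding lattice_points_def by blast
  define d where "d s = int ((m * s) mod N) - int ((n * s) mod N)" for s
  have comps: "(x - y) $ 1 = of_int (d 1)" "(x - y) $ 2 = of_int (d b)" "(x - y) $ 3 = of_int (d (b\<^sup>2))"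
    by (simp_all add: m n d_def)
  have "x - y \<noteq> 0"
    using \<open>x \<noteq> y\<close> by simp
  then have nz: "d 1 \<noteq> 0 \<or> d b \<noteq> 0 \<or> d (b\<^sup>2) \<noteq> 0"
    using comps unfolding vec_eq_iff forall_3 by auto
  have "[b\<^sup>2 * b = 1] (mod N)"
  proof -
    have "b\<^sup>2 * b = 2 * N + 1"
      using N by (simp add: power2_eq_square power3_eq_cube)
    then show ?thesis
      by (metis cong_def mod_mult_self3)
  qed
  then have "int N dvd int b * d 1 - d b" "int N dvd int b * d b - d (b\<^sup>2)"
    "int N dvd int b * d (b\<^sup>2) - d 1"
    unfolding d_def by (intro cyclic_dvd_mod_diff; simp add: power2_eq_square)+
  moreover have "int b ^ 3 = 2 * int N + 1"
    using N by (metis of_nat_1 of_nat_add of_nat_mult of_nat_numeral of_nat_power)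
  ultimately have "(int b - 1) * int N \<le> (d 1)\<^sup>2 + (d b)\<^sup>2 + (d (b\<^sup>2))\<^sup>2"
    using b nz by (intro cyclic_lattice_norm_ge) auto
  then have "real_of_int ((int b - 1) * int N) \<le> real_of_int ((d 1)\<^sup>2 + (d b)\<^sup>2 + (d (b\<^sup>2))\<^sup>2)"
    by (simp only: of_int_le_iff)
  then have "(real b - 1) * real N \<le> (norm (x - y))\<^sup>2"
    unfolding norm_sq_3 comps by simp
  then show ?thesis
    by (intro real_le_lsqrt) auto
qed

lemma lattice_points_dist_attained:
  fixes k b N :: nat
  assumes k: "k \<ge> 1" and b: "b = 2 * k + 1" and N: "N = k * (4 * k\<^sup>2 + 6 * k + 3)"
  shows "\<exists>x y. x \<in> lattice_points N (vector [1, b, b\<^sup>2] :: nat ^ 3)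
    \<and> y \<in> lattice_points N (vector [1, b, b\<^sup>2] :: nat ^ 3) \<and> x \<noteq> y
    \<and> norm (x - y) = sqrt ((real b - 1) * real N)"
proof -
  let ?v = "vector [1, b, b\<^sup>2] :: nat ^ 3"
  \<comment> \<open>The target difference is \<open>(b * k, - (2 * k^2 + 2 * k), k)\<close>, which
    belongs to \<open>(p, q, r) = (1, -1, 0)\<close>. The base point is \<open>n = b\<close> rather
    than \<open>n = 0\<close> because the second coordinate must be able to decrease by
    \<open>2 * k^2 + 2 * k\<close> and stay nonnegative.\<close>
  define pt where "pt n = (\<chi> i. real ((n * ?v $ i) mod N))" for n
  \<comment> \<open>With the powers of \<open>k\<close> treated as atoms, these bounds make the
    comparisons with \<open>N\<close> linear.\<close>
  have "k\<^sup>2 \<le> k * k\<^sup>2" "k \<le> k\<^sup>2"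
    using k by (auto simp: power2_eq_square)
  moreover have "N = 4 * (k * k\<^sup>2) + 6 * k\<^sup>2 + 3 * k"
    by (simp add: N algebra_simps power2_eq_square)
  moreover have "b * (k + 1) = 2 * k\<^sup>2 + 3 * k + 1" "b\<^sup>2 = 4 * k\<^sup>2 + 4 * k + 1"
    by (simp_all add: b algebra_simps power2_eq_square)
  ultimately have lt: "b * (k + 1) < N" "b\<^sup>2 < N" "b < N" "k + 1 < N" "2 * k\<^sup>2 + 2 * k + 1 < N" "1 < N"
    using k b by linarith+
  have cube: "b * b\<^sup>2 = 1 + N * 2"
    by (simp add: b N algebra_simps power2_eq_square)
  have "b * (k + 1) * b = (2 * k\<^sup>2 + 2 * k + 1) + N"
    by (simp add: b N algebra_simps power2_eq_square)
  then have s2: "(b * (k + 1) * b) mod N = 2 * k\<^sup>2 + 2 * k + 1"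
    using lt by (metis mod_add_self2 mod_less)
  have "b * (k + 1) * b\<^sup>2 = (k + 1) + N * (2 * (k + 1))"
    using cube by (metis (no_types, lifting) add_mult_distrib mult.assoc mult.commute mult_1)
  then have s3: "(b * (k + 1) * b\<^sup>2) mod N = k + 1"
    using lt by (metis mod_less mod_mult_self2)
  have t3: "(b * b\<^sup>2) mod N = 1"
    using cube lt by (metis mod_less mod_mult_self2)
  have t2: "(b * b) mod N = b\<^sup>2"
    using lt by (simp add: power2_eq_square)
  have comps: "(pt (b * (k + 1)) - pt b) $ 1 = real b * (real k + 1) - real b"
    "(pt (b * (k + 1)) - pt b) $ 2 = 2 * (real k)\<^sup>2 + 2 * real k + 1 - (real b)\<^sup>2"
    "(pt (b * (k + 1)) - pt b) $ 3 = real k"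
    using s2 s3 t2 t3 lt unfolding pt_def by (simp_all del: mult_Suc_right add_Suc_right)
  have "(norm (pt (b * (k + 1)) - pt b))\<^sup>2 = (real b - 1) * real N"
    unfolding norm_sq_3 comps by (simp add: b N algebra_simps power2_eq_square)
  then have "norm (pt (b * (k + 1)) - pt b) = sqrt ((real b - 1) * real N)"
    by (metis norm_ge_zero real_sqrt_unique)
  moreover have "pt (b * (k + 1)) \<noteq> pt b"
    using comps(3) k by auto
  moreover have "pt (b * (k + 1)) \<in> lattice_points N ?v" "pt b \<in> lattice_points N ?v"
    using lt unfolding lattice_points_def pt_def by blast+
  ultimately show ?thesis
    by blast
qed

lemma min_dist_lattice_points:
  fixes k b N :: nat
  assumes k: "k \<ge> 1" and b: "b = 2 * k + 1" and N: "N = k * (4 * k\<^sup>2 + 6 * k + 3)"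
  shows "min_dist (lattice_points N (vector [1, b, b\<^sup>2] :: nat ^ 3)) = sqrt ((real b - 1) * real N)"
proof -
  let ?P = "lattice_points N (vector [1, b, b\<^sup>2] :: nat ^ 3)"
  have cube: "b ^ 3 = 2 * N + 1"
    by (simp add: b N algebra_simps power2_eq_square power3_eq_cube)
  \<comment> \<open>\<open>Min\<close> is characterised by a lower bound that is attained only on a
    finite set, so finiteness of the set of distances comes first.\<close>
  have "finite ?P"
    unfolding lattice_points_def by (rule finite_image_set) simp
  then have "finite ((\<lambda>(x, y). norm (x - y)) ` (?P \<times> ?P))"
    by blast
  moreover have "{norm (x - y) | x y. x \<in> ?P \<and> y \<in> ?P \<and> x \<noteq> y} \<subseteq> (\<lambda>(x, y). norm (x - y)) ` (?P \<times> ?P)"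
    by auto
  ultimately have "finite {norm (x - y) | x y. x \<in> ?P \<and> y \<in> ?P \<and> x \<noteq> y}"
    by (rule finite_subset[rotated])
  moreover have "sqrt ((real b - 1) * real N) \<le> d"
    if "d \<in> {norm (x - y) | x y. x \<in> ?P \<and> y \<in> ?P \<and> x \<noteq> y}" for d
    using that lattice_points_dist_ge[OF _ _ cube] k b by auto
  moreover have "sqrt ((real b - 1) * real N) \<in> {norm (x - y) | x y. x \<in> ?P \<and> y \<in> ?P \<and> x \<noteq> y}"
    using lattice_points_dist_attained[OF assms] by force
  ultimately show ?thesis
    unfolding min_dist_def by (intro Min_eqI) auto
qed

theorem theorem3:
  shows "(\<lambda>k::nat.
      let b = 2 * k + 1;
          N = (b ^ 3 - 1) div 2;
          v = vector [1, b, b ^ 2] :: nat ^ 3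
      in min_dist (lattice_points N v) / real N powr (2 / 3))
    \<longlonglongrightarrow> 2 powr (1 / 6)"
proof -
  have N: "((2 * k + 1) ^ 3 - 1) div 2 = k * (4 * k\<^sup>2 + 6 * k + 3)" for k :: nat
  proof -
    have "(2 * k + 1) ^ 3 = 2 * (k * (4 * k\<^sup>2 + 6 * k + 3)) + 1"
      by (simp add: algebra_simps power2_eq_square power3_eq_cube)
    then show ?thesis
      by simp
  qed
  let ?M = "\<lambda>k::nat. real k * (4 * (real k)\<^sup>2 + 6 * real k + 3)"
  have "(\<lambda>k. sqrt (2 * real k * ?M k) / ?M k powr (2 / 3)) \<longlonglongrightarrow> 2 powr (1 / 6)"
  proof -
    \<comment> \<open>The leading term of \<open>?M k\<close> is \<open>4 * k^3\<close>, so the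
      numerator grows like \<open>sqrt 8 * k^2\<close> and the denominator like
      \<open>4 powr (2 / 3) * k^2\<close>; the exponents of 2 combine to
      \<open>3 / 2 - 4 / 3 = 1 / 6\<close>.\<close>
    have "(\<lambda>k. sqrt (2 * real k * ?M k) / ?M k powr (2 / 3))
        \<longlonglongrightarrow> 8 powr (1 / 2) * inverse (4 powr (2 / 3))"
      by real_asymp
    moreover have "8 powr (1 / 2) * inverse (4 powr (2 / 3)) = (2::real) powr (1 / 6)"
    proof -
      have "8 powr (1 / 2) = (2::real) powr (3 / 2)"
        using powr_powr[of 2 3 "1 / 2"] by simp
      moreover have "4 powr (2 / 3) = (2::real) powr (4 / 3)"
        using powr_powr[of 2 2 "2 / 3"] by simp
      ultimately show ?thesis
        by (simp flip: powr_minus powr_add)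
    qed
    ultimately show ?thesis
      by simp
  qed
  \<comment> \<open>The closed form is available from \<open>k = 1\<close> on: for
    \<open>k = 0\<close> one has \<open>N = 0\<close>, and the point set is empty.\<close>
  moreover have "\<forall>\<^sub>F k in sequentially. sqrt (2 * real k * ?M k) / ?M k powr (2 / 3) =
      (let b = 2 * k + 1; N = (b ^ 3 - 1) div 2; v = vector [1, b, b ^ 2] :: nat ^ 3
       in min_dist (lattice_points N v) / real N powr (2 / 3))"
    using eventually_ge_at_top[of 1]
  proof eventually_elim
    case (elim k)
    show ?case
      unfolding Let_def N min_dist_lattice_points[OF elim refl refl] by simp
  qed
  ultimately show ?thesis
    by (rule Lim_transform_eventually)
qed

end
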